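(* Let $Q$ be a polynomial of degree $n\ge 1$ with positive real roots, and let $(r_j)_{1\le j\le n}$ be a strictly increasing sequence of positive real numbers. Assume that for some $\alpha\in(0,1)$, $$\max_{1\le j\le n-1}\frac{r_j}{r_{j+1}}\le \alpha,$$ and define $$y:=\frac{2+\log_-(\log(\alpha^{-1}))}{\log(\alpha^{-1})}.$$ Suppose that the $j$-th smallest root of $Q$ is at most $r_j$ for $1\le j\le n$. Then, for all integers $m\ge 1$, $1\le q\le m-1$ and $1\le j\le n$, all roots of the polynomial $$S(z)=q\,Q(z)+m\,z\,Q'(z)$$ are real and positive, and the $j$-th smallest root of $S$ is at most $$\left(1-\frac{\alpha}{j+2+2y}\right)r_j .$$ For $2\le j\le n$, the $(j-1)$-th smallest root of $Q'$, which has all real and positive roots, is at most $$\left(1-\frac{\alpha}{j+2+2y}\right)r_j .$$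
   Context: $\log_-$ denotes the negative part of the logarithm: $\log_-(x)=\max(0,-\log x)$ for $x>0$. "All roots real and positive" means that all complex roots are positive real numbers; roots are counted with multiplicity, and the $j$-th smallest root refers to the nondecreasing ordering of the roots with multiplicity. For $n=1$ the condition on the ratios $r_j/r_{j+1}$ is empty. *)

theory Defs
  imports Complex_Main "HOL-Computational_Algebra.Computational_Algebra"
begin

definition ln_minus :: "real \<Rightarrow> real" where
  "ln_minus x = max 0 (- ln x)"

text \<open>The zero polynomial does not satisfy this predicate, since it vanishes at 0.
  A nonzero constant polynomial satisfies it vacuously.\<close>

definition all_roots_pos :: "complex poly \<Rightarrow> bool" where
  "all_roots_pos p \<longleftrightarrow> (\<forall>z. poly p z = 0 \<longrightarrow> z \<in> \<real> \<and> Re z > 0)"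

text \<open>Intended for polynomials whose roots are all real, so that \<^const>\<open>Re\<close> merely
  changes the type, and for indices from 1 to the degree. The multiset \<^const>\<open>proots\<close>
  contains each root with its multiplicity.\<close>

definition jth_smallest_root :: "complex poly \<Rightarrow> nat \<Rightarrow> real" where
  "jth_smallest_root p j = sorted_list_of_multiset (image_mset Re (proots p)) ! (j - 1)"

end

theory Submission
  imports Defs
begin

text \<open>Write \<open>F z = \<Sum> z / (z - a)\<close> over the roots \<open>a\<close> of \<open>Q\<close>, so that \<open>S = m Q (c + F)\<close> with
  \<open>c = q / m\<close>, and \<open>c = 0\<close> gives \<open>z Q'\<close>. Rolle's theorem for \<open>z powr c * Q z\<close> puts a zero of
  \<open>c + F\<close> into the gap to the left of each distinct root; together with the roots of \<open>Q\<close>, each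
  with its multiplicity lowered by one, these exhaust the roots of \<open>S\<close>. Since \<open>F\<close> decreases on
  gaps, \<open>F t \<le> -1\<close> for a point \<open>t\<close> to the left of the \<open>j\<close>-th root forces the critical zero below \<open>t\<close>.
  At \<open>t = (1 - \<delta>) r\<^sub>j\<close> this inequality reduces to a bound on \<open>\<Sum> \<alpha>\<^sup>i / (1 - \<alpha>\<^sup>i)\<close>.\<close>

section \<open>Critical zeros in the gaps between roots\<close>

lemma poly_pderiv_prod_linear:
  fixes z :: "'a :: field"
  assumes "z \<notin># A"
  shows "poly (pderiv (\<Prod>x\<in>#A. [:- x, 1:])) z = (\<Prod>x\<in>#A. z - x) * (\<Sum>x\<in>#A. 1 / (z - x))"
  using assms
proof (induction A)
  case (add a A)
  then have "z - a \<noteq> 0" by auto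
  have e: "poly (\<Prod>x\<in>#A. [:- x, 1:]) z = (\<Prod>x\<in>#A. z - x)"
    by (simp add: poly_prod_mset image_mset.compositionality o_def)
  show ?case
    using add \<open>z - a \<noteq> 0\<close>
    by (simp only: image_mset_add_mset prod_mset.add_mset sum_mset.add_mset pderiv_mult poly_add poly_mult e)
       (simp add: field_simps pderiv_pCons)
qed auto

text \<open>Rolle is applied between \<open>p\<close>, the nearest root below \<open>x\<close> or 0
  if there is none, and \<open>x\<close>. On the open interval the derivative of
  \<open>z powr c * (\<Prod>a\<in>#A. z - a)\<close> is a nonvanishing factor times
  \<open>c + (\<Sum>a\<in>#A. z / (z - a))\<close>.\<close>

lemma exists_critical_point_in_gap:
  fixes A :: "real multiset" and c x :: real
  assumes pos: "\<forall>a\<in>#A. 0 < a" and c: "0 \<le> c" and x: "x \<in># A"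
  shows "\<exists>g\<ge>0. g < x \<and> {g..<x} \<inter> set_mset A = {} \<and> c + (\<Sum>a\<in>#A. g / (g - a)) = 0"
proof -
  define p where "p = Max (insert 0 {a \<in> set_mset A. a < x})"
  have p_in: "p \<in> insert 0 {a \<in> set_mset A. a < x}"
    unfolding p_def by (rule Max_in) auto
  have p_max: "a \<le> p" if "a \<in># A" "a < x" for a
    unfolding p_def using that by (intro Max_ge) auto
  have p: "0 \<le> p" "p < x"
    using p_in pos x by (auto intro: less_imp_le)
  show ?thesis
  proof (cases "c = 0 \<and> p = 0")
    case True
    \<comment> \<open>Rolle does not apply here; the witness 0 is the extra root of \<open>z Q'\<close>.\<close>
    then show ?thesis
      using p p_max pos by (intro exI[of _ 0]) force
  next
    case False
    define h where "h z = z powr c * (\<Prod>a\<in>#A. z - a)" for z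
    define h' where "h' z = z powr (c - 1) * (\<Prod>a\<in>#A. z - a) * (c + (\<Sum>a\<in>#A. z / (z - a)))" for z
    have notin: "z \<notin># A" if "p < z" "z < x" for z
      using p_max that by force
    have prod_poly: "(\<Prod>a\<in>#A. z - a) = poly (\<Prod>a\<in>#A. [:- a, 1:]) z" for z :: real
      by (simp add: poly_prod_mset image_mset.compositionality o_def)
    have root: "(\<Prod>a\<in>#A. z - a) = 0" if "z \<in># A" for z
      using that by (auto simp: prod_mset_zero_iff)
    \<comment> \<open>At \<open>p = 0\<close> the factor \<open>0 powr c\<close> vanishes; otherwise
      \<open>p\<close> is a root and the product does.\<close>
    have "h p = 0"
      using p_in root by (auto simp: h_def)
    moreover have "h x = 0"
      using x root by (auto simp: h_def)
    moreover have "continuous_on {p..x} h"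
      unfolding h_def prod_poly using p False p_in pos c
      by (intro continuous_intros continuous_on_powr') auto
    moreover have deriv: "(h has_real_derivative h' z) (at z)" if "p < z" "z < x" for z
    proof -
      have "z > 0" using that p by linarith
      have e: "(\<Sum>a\<in>#A. z / (z - a)) = z * (\<Sum>a\<in>#A. 1 / (z - a))"
        by (simp add: sum_mset_distrib_left)
      have "((\<lambda>z. poly (\<Prod>a\<in>#A. [:- a, 1:]) z) has_real_derivative
          (\<Prod>a\<in>#A. z - a) * (\<Sum>a\<in>#A. 1 / (z - a))) (at z)"
        using poly_DERIV[of "\<Prod>a\<in>#A. [:- a, 1:]" z]
        by (simp only: poly_pderiv_prod_linear[OF notin[OF that]])
      from DERIV_mult[OF has_real_derivative_powr[OF \<open>z > 0\<close>, of c] this]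
      have "(h has_real_derivative c * z powr (c - 1) * (\<Prod>a\<in>#A. z - a)
          + (\<Prod>a\<in>#A. z - a) * (\<Sum>a\<in>#A. 1 / (z - a)) * z powr c) (at z)"
        unfolding h_def prod_poly .
      moreover have "z powr c = z powr (c - 1) * z"
        using \<open>z > 0\<close> by (simp add: powr_diff)
      ultimately show ?thesis
        unfolding h'_def e by (simp only: algebra_simps)
    qed
    \<comment> \<open>Rolle delivers the derivative as a linear map that vanishes; its value at 1 is
      \<open>h' g\<close>.\<close>
    ultimately have "\<exists>g. p < g \<and> g < x \<and> (*) (h' g) = (\<lambda>v. 0)"
      using p by (intro Rolle_deriv[of p x h]) (auto simp: has_field_derivative_def)
    then obtain g where g: "p < g" "g < x" "(*) (h' g) = (\<lambda>v. 0)" by blast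
    have "h' g = 0" using fun_cong[OF g(3), of 1] by simp
    moreover have "(\<Prod>a\<in>#A. g - a) \<noteq> 0"
      using notin[OF g(1,2)] by (auto simp: prod_mset_zero_iff)
    ultimately show ?thesis
      using g p notin by (intro exI[of _ g]) (auto simp: h'_def)
  qed
qed

section \<open>The full root multiset of \<open>c P + z P'\<close>\<close>

text \<open>In characteristic 0 differentiation lowers the order of a root by exactly one, so the
  power of \<open>[:- a, 1:]\<close> with exponent \<open>order a P - 1\<close> divides both
  summands of \<open>S\<close>.\<close>

lemma order_smult_add_X_pderiv:
  fixes P :: "'a :: field_char_0 poly"
  assumes S: "S = smult c P + [:0, 1:] * pderiv P" "S \<noteq> 0" and "poly P a = 0"
  shows "order a P - 1 \<le> order a S"
proof -
  have "P \<noteq> 0" using S by auto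
  have "order a P = Suc (order a (pderiv P))"
    using order_pderiv[OF \<open>P \<noteq> 0\<close>] assms(3) .
  then have "[:- a, 1:] ^ (order a P - 1) dvd P" "[:- a, 1:] ^ (order a P - 1) dvd pderiv P"
    by (auto simp: order_divides)
  then have "[:- a, 1:] ^ (order a P - 1) dvd S"
    unfolding S(1) by (intro dvd_add dvd_smult dvd_mult)
  then show ?thesis using S(2) by (simp add: order_divides)
qed

lemma proots_prod_linear:
  fixes A :: "'a :: idom multiset"
  shows "proots (\<Prod>a\<in>#A. [:- a, 1:]) = A"
proof (induction A)
  case (add a A)
  have "[:- a, 1:] * (\<Prod>a\<in>#A. [:- a, 1:]) \<noteq> 0"
    by (auto simp: prod_mset_zero_iff simp del: mult_pCons_left)
  then show ?case using add by (simp add: proots_mult del: mult_pCons_left)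
qed simp

lemma degree_prod_linear:
  fixes A :: "'a :: idom multiset"
  shows "degree (\<Prod>a\<in>#A. [:- a, 1:]) = size A"
proof (induction A)
  case (add a A)
  have "(\<Prod>a\<in>#A. [:- a, 1:]) \<noteq> 0"
    by (auto simp: prod_mset_zero_iff)
  then show ?case using add by (simp add: degree_mult_eq del: mult_pCons_left)
qed simp

lemma poly_prod_linear_of_real:
  "poly (\<Prod>a\<in>#image_mset of_real A. [:- a, 1:]) (of_real z)
     = (of_real (\<Prod>a\<in>#A. z - a) :: 'a :: {real_algebra_1,idom})"
  by (induction A) (auto simp: algebra_simps)

lemma poly_pderiv_prod_linear_of_real:
  assumes "z \<notin># A"
  shows "poly (pderiv (\<Prod>a\<in>#image_mset of_real A. [:- a, 1:])) (of_real z)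
     = (of_real ((\<Prod>a\<in>#A. z - a) * (\<Sum>a\<in>#A. 1 / (z - a))) :: 'a :: real_field)"
proof -
  have "of_real z \<notin># (image_mset of_real A :: 'a multiset)" using assms by auto
  note poly_pderiv_prod_linear[OF this]
  also have "(\<Prod>a\<in>#image_mset of_real A. of_real z - a) = (of_real (\<Prod>a\<in>#A. z - a) :: 'a)"
    by (induction A) auto
  also have "(\<Sum>a\<in>#image_mset of_real A. 1 / (of_real z - a))
      = (of_real (\<Sum>a\<in>#A. 1 / (z - a)) :: 'a)"
    by (induction A) auto
  finally show ?thesis by (simp only: of_real_mult)
qed

lemma count_image_mset_of_inj:
  assumes "inj f"
  shows "count (image_mset f A) (f a) = count A a"
  using assms by (induction A) (auto simp: inj_eq)

text \<open>A counting argument. The multiset on the right is contained in \<open>proots S\<close>.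
  It has size \<open>size A\<close>, since every distinct root gives up one copy and contributes one
  critical zero. As \<open>degree S \<le> size A\<close>, there is no room for further roots, and in
  particular none for nonreal ones.\<close>

lemma proots_smult_add_X_pderiv:
  fixes A :: "real multiset" and c :: real and P :: "complex poly"
  assumes pos: "\<forall>a\<in>#A. 0 < a" and ne: "A \<noteq> {#}" and c: "0 \<le> c"
    and P: "P = (\<Prod>a\<in>#image_mset of_real A. [:- a, 1:])"
    and S: "S = smult (of_real c) P + [:0, 1:] * pderiv P"
    and g: "\<And>x. x \<in># A \<Longrightarrow> g x < x \<and> {g x..<x} \<inter> set_mset A = {} \<and>
              c + (\<Sum>a\<in>#A. g x / (g x - a)) = 0"
  shows "proots S = image_mset of_real (A - mset_set (set_mset A) + image_mset g (mset_set (set_mset A)))"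
proof -
  have degP: "degree P = size A" unfolding P by (simp add: degree_prod_linear)
  have "P \<noteq> 0" unfolding P by (auto simp: prod_mset_zero_iff)
  have proots_P: "proots P = image_mset of_real A"
    unfolding P by (rule proots_prod_linear)
  have "size A > 0" using ne by (simp add: nonempty_has_size)
  have degS_le: "degree S \<le> size A"
    unfolding S using degP degree_pderiv[of P] \<open>size A > 0\<close>
    by (intro degree_add_le) auto
  \<comment> \<open>The factor \<open>c + size A\<close> is positive, which excludes
    \<open>S = 0\<close>.\<close>
  have "coeff S (size A) = (of_real c + of_nat (size A)) * lead_coeff P"
    using \<open>size A > 0\<close> by (cases "size A") (auto simp: S degP coeff_pderiv algebra_simps)
  moreover have "of_real c + of_nat (size A) \<noteq> (0 :: complex)"
  proof -
    have "of_real c + of_nat (size A) = (of_real (c + size A) :: complex)" by simp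
    moreover have "c + size A \<noteq> 0" using \<open>size A > 0\<close> c by linarith
    ultimately show ?thesis by (metis of_real_eq_0_iff)
  qed
  ultimately have "S \<noteq> 0" using \<open>P \<noteq> 0\<close> by auto
  have gA: "g x \<notin># A" if "x \<in># A" for x
    using g[OF that] by force
  have Sg: "poly S (of_real (g x)) = 0" if "x \<in># A" for x
  proof -
    have "(\<Sum>a\<in>#A. g x / (g x - a)) = g x * (\<Sum>a\<in>#A. 1 / (g x - a))"
      by (simp add: sum_mset_distrib_left)
    then have "c + g x * (\<Sum>a\<in>#A. 1 / (g x - a)) = 0" using g[OF that] by simp
    moreover have "poly S (of_real (g x))
        = of_real ((\<Prod>a\<in>#A. g x - a) * (c + g x * (\<Sum>a\<in>#A. 1 / (g x - a))))"
      unfolding S P using poly_pderiv_prod_linear_of_real[OF gA[OF that], where 'a=complex]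
        poly_prod_linear_of_real[of A "g x", where 'a=complex]
      by (simp add: algebra_simps)
    ultimately show ?thesis by simp
  qed
  \<comment> \<open>For roots \<open>x < x'\<close>, the root \<open>x\<close> lies strictly between
    \<open>g x\<close> and \<open>g x'\<close>.\<close>
  have inj: "inj_on g (set_mset A)"
  proof (rule linorder_inj_onI')
    fix x x' assume "x \<in># A" "x' \<in># A" "x < x'"
    then have "g x < x" "x \<notin> {g x'..<x'}" using g[of x] g[of x'] by blast+
    with \<open>x < x'\<close> have "g x < x" "x < g x'" by auto
    then show "g x \<noteq> g x'" by simp
  qed
  define M where "M = A - mset_set (set_mset A) + image_mset g (mset_set (set_mset A))"
  have imM: "image_mset g (mset_set (set_mset A)) = mset_set (g ` set_mset A)"
    using inj by (rule image_mset_mset_set)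
  have cnt: "count M a \<le> order (of_real a) S" for a
  proof (cases "a \<in># A")
    \<comment> \<open>No critical zero is itself a root, so at a root \<open>a\<close> only the
      lowered multiplicity counts.\<close>
    case True
    then have "count M a = count A a - 1"
      unfolding M_def imM using gA by (auto simp: count_mset_set')
    also have "count A a = order (of_real a :: complex) P"
    proof -
      have "count (proots P) (of_real a) = count A a"
        unfolding proots_P by (rule count_image_mset_of_inj) (simp add: inj_of_real)
      then show ?thesis using \<open>P \<noteq> 0\<close> by simp
    qed
    also have "order (of_real a) P - 1 \<le> order (of_real a) S"
    proof (rule order_smult_add_X_pderiv[OF S \<open>S \<noteq> 0\<close>])
      show "poly P (of_real a) = 0"
        using True \<open>P \<noteq> 0\<close> proots_P set_count_proots[OF \<open>P \<noteq> 0\<close>] by auto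
    qed
    finally show ?thesis .
  next
    case False
    show ?thesis
    proof (cases "a \<in> g ` set_mset A")
      case True
      then have "order (of_real a) S > 0"
        using Sg \<open>S \<noteq> 0\<close> by (auto simp: order_gt_0_iff)
      then show ?thesis
        unfolding M_def imM using False True
        by (simp add: count_mset_set' not_in_iff)
    next
      case F2: False
      then show ?thesis unfolding M_def imM using False
        by (simp add: count_mset_set' not_in_iff)
    qed
  qed
  have sub: "image_mset of_real M \<subseteq># proots S"
  proof (rule mset_subset_eqI)
    fix z :: complex
    show "count (image_mset of_real M) z \<le> count (proots S) z"
    proof (cases "z \<in> range (of_real :: real \<Rightarrow> complex)")
      case True
      then obtain a where z: "z = of_real a" by auto
      then have "count (image_mset of_real M) z = count M a"
        by (simp add: count_image_mset_of_inj inj_of_real)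
      then show ?thesis using cnt[of a] \<open>S \<noteq> 0\<close> z by simp
    next
      case False
      then have "z \<notin># image_mset of_real M" by auto
      then show ?thesis by (simp only: not_in_iff)
    qed
  qed
  have "mset_set (set_mset A) \<subseteq># A"
    by (rule mset_set_set_mset_msubset)
  then have "size M = size A"
    unfolding M_def using size_mset_mono[of "mset_set (set_mset A)" A]
    by (simp only: size_union size_image_mset size_Diff_submset) simp
  then have "size (proots S) \<le> size (image_mset (of_real :: real \<Rightarrow> complex) M)"
    using size_proots_le[of S] degS_le by simp
  with sub show ?thesis
    unfolding M_def[symmetric] by (metis mset_subset_size linorder_not_less subset_mset.le_less)
qed

section \<open>Counting roots below a threshold\<close>

text \<open>Termwise, \<open>t / (t - a) - s / (s - a)\<close> equals
  \<open>a * (s - t) / ((t - a) * (s - a))\<close>. The denominator is positive because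
  \<open>a\<close> lies outside the interval from \<open>t\<close> to \<open>s\<close>.\<close>

lemma sum_mset_ratio_strict_decreasing:
  fixes A :: "real multiset"
  assumes "\<forall>a\<in>#A. 0 < a" "A \<noteq> {#}" "t < s" "{t..s} \<inter> set_mset A = {}"
  shows "(\<Sum>a\<in>#A. s / (s - a)) < (\<Sum>a\<in>#A. t / (t - a))"
proof -
  have less: "s / (s - a) < t / (t - a)" if "a \<in># A" for a
  proof -
    have "a \<notin> {t..s}" using assms(4) that by blast
    then have "0 < (t - a) * (s - a)"
      using \<open>t < s\<close> by (auto simp: zero_less_mult_iff)
    moreover have "0 < a" using \<open>\<forall>a\<in>#A. 0 < a\<close> that by blast
    moreover have "t / (t - a) - s / (s - a) = a * (s - t) / ((t - a) * (s - a))"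
      using \<open>a \<notin> {t..s}\<close> \<open>t < s\<close> by (subst diff_frac_eq) (auto simp: algebra_simps)
    ultimately show ?thesis
      using \<open>t < s\<close> by (smt (verit) divide_pos_pos mult_pos_pos)
  qed
  from \<open>A \<noteq> {#}\<close> obtain a B where "A = add_mset a B" by (meson multiset_cases)
  then show ?thesis
    using less by (simp only: image_mset_add_mset sum_mset.add_mset)
      (intro add_less_le_mono sum_mset_mono less_imp_le; simp)
qed

text \<open>Passing from \<open>A\<close> to \<open>M\<close> moves one copy of each distinct root
  \<open>x\<close> left to \<open>g x\<close>, so no count below \<open>t\<close> can drop. It grows
  strictly as soon as some root above \<open>t\<close> has its critical zero at or below
  \<open>t\<close>.\<close>

lemma size_filter_proots_combination:
  fixes A :: "real multiset" and t :: real
  assumes pos: "\<forall>a\<in>#A. 0 < a"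
    and g: "\<And>x. x \<in># A \<Longrightarrow> g x < x \<and> {g x..<x} \<inter> set_mset A = {} \<and>
              c + (\<Sum>a\<in>#A. g x / (g x - a)) = 0"
    and M: "M = A - mset_set (set_mset A) + image_mset g (mset_set (set_mset A))"
  shows "size (filter_mset (\<lambda>x. x \<le> t) A) \<le> size (filter_mset (\<lambda>x. x \<le> t) M)"
    and "\<lbrakk>t \<notin># A; \<exists>x\<in>#A. t < x; c + (\<Sum>a\<in>#A. t / (t - a)) \<le> 0\<rbrakk> \<Longrightarrow>
      size (filter_mset (\<lambda>x. x \<le> t) A) < size (filter_mset (\<lambda>x. x \<le> t) M)"
proof -
  let ?R = "{x \<in> set_mset A. x \<le> t}" and ?G = "{x \<in> set_mset A. g x \<le> t}"
  have "mset_set ?R \<subseteq># filter_mset (\<lambda>x. x \<le> t) A"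
    using mset_set_set_mset_msubset[of "filter_mset (\<lambda>x. x \<le> t) A"] by simp
  then have szA: "card ?R \<le> size (filter_mset (\<lambda>x. x \<le> t) A)"
      "size (filter_mset (\<lambda>x. x \<le> t) A - mset_set ?R) = size (filter_mset (\<lambda>x. x \<le> t) A) - card ?R"
    using size_mset_mono[of "mset_set ?R"] by (auto simp: size_Diff_submset)
  have szM: "size (filter_mset (\<lambda>x. x \<le> t) M) = size (filter_mset (\<lambda>x. x \<le> t) A) - card ?R + card ?G"
    unfolding M by (simp add: filter_mset_image_mset szA)
  have sub: "?R \<subseteq> ?G" using g by force
  show "size (filter_mset (\<lambda>x. x \<le> t) A) \<le> size (filter_mset (\<lambda>x. x \<le> t) M)"
    using card_mono[OF _ sub] szA(1) unfolding szM by simp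
  assume t: "t \<notin># A" "\<exists>x\<in>#A. t < x" "c + (\<Sum>a\<in>#A. t / (t - a)) \<le> 0"
  \<comment> \<open>The first root above \<open>t\<close> is the one whose critical zero crosses
    \<open>t\<close>: if \<open>t < g y\<close>, strict decrease on the root-free interval from
    \<open>t\<close> to \<open>g y\<close> would make \<open>c + F t\<close> positive.\<close>
  define y where "y = Min {x \<in> set_mset A. t < x}"
  have y: "y \<in># A" "t < y"
    using Min_in[of "{x \<in> set_mset A. t < x}", folded y_def] t(2) by auto
  have y_min: "y \<le> x" if "x \<in># A" "t < x" for x
    using that by (auto simp: y_def intro: Min_le)
  have "g y \<le> t"
  proof (rule ccontr)
    assume "\<not> g y \<le> t"
    then have "t < g y" by simp
    moreover have "{t..g y} \<inter> set_mset A = {}"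
      using t(1) y_min g[OF y(1)] by (force simp: order.order_iff_strict)
    ultimately show False
      using sum_mset_ratio_strict_decreasing[of A t "g y"] pos y g[OF y(1)] t(3) by force
  qed
  then have "?R \<subset> ?G" using y sub by force
  then have "card ?R < card ?G" by (intro psubset_card_mono) auto
  then show "size (filter_mset (\<lambda>x. x \<le> t) A) < size (filter_mset (\<lambda>x. x \<le> t) M)"
    using szA(1) unfolding szM by simp
qed

section \<open>Order statistics expressed as counts\<close>

lemma sorted_nth_le_iff_length_filter:
  assumes "sorted xs" "k < length xs"
  shows "xs ! k \<le> t \<longleftrightarrow> k < length (filter (\<lambda>x. x \<le> t) xs)"
  using assms
proof (induction xs arbitrary: k)
  case (Cons x xs)
  show ?case
  proof (cases "x \<le> t")
    case True
    then show ?thesis using Cons by (cases k) auto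
  next
    case False
    then have "\<forall>z\<in>set (x # xs). \<not> z \<le> t" using Cons.prems by auto
    moreover from this have "filter (\<lambda>x. x \<le> t) (x # xs) = []" by (simp add: filter_empty_conv)
    ultimately show ?thesis using Cons.prems(2) nth_mem[of k "x # xs"] by (metis list.size(3) not_less0)
  qed
qed simp

text \<open>Translates bounds on the j-th smallest root into counts, so that the roots of
  \<open>S\<close> need not be listed in order. Positions start at 0 here.\<close>

lemma sorted_list_of_multiset_nth_le_iff:
  assumes "k < size A"
  shows "sorted_list_of_multiset A ! k \<le> t \<longleftrightarrow> k < size (filter_mset (\<lambda>x. x \<le> t) A)"
proof -
  have "size (filter_mset (\<lambda>x. x \<le> t) A) = length (filter (\<lambda>x. x \<le> t) (sorted_list_of_multiset A))"
    by (metis mset_filter mset_sorted_list_of_multiset size_mset)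
  moreover have "length (sorted_list_of_multiset A) = size A"
    by (metis mset_sorted_list_of_multiset size_mset)
  ultimately show ?thesis
    using assms by (simp add: sorted_nth_le_iff_length_filter)
qed

section \<open>Estimates in terms of \<alpha> and \<open>y\<close>\<close>

text \<open>Everything follows from \<open>ln x \<le> x - 1\<close> and
  \<open>1 + x \<le> exp x\<close>. The latter gives \<open>L / (1 + L) \<le> 1 - \<alpha>\<close>,
  hence \<open>- ln (1 - \<alpha>) \<le> ln (1 + L) - ln L\<close>.\<close>

lemma ln_inverse_bounds:
  fixes \<alpha> :: real
  assumes "0 < \<alpha>" "\<alpha> < 1"
  defines "L \<equiv> ln (inverse \<alpha>)"
  shows "0 < L" "\<alpha> / (1 - \<alpha>) \<le> 1 / L" "- ln (1 - \<alpha>) \<le> 1 + ln_minus L"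
proof -
  show L: "0 < L" unfolding L_def using assms by (simp add: one_less_inverse_iff)
  have "L \<le> inverse \<alpha> - 1" unfolding L_def using assms by (intro ln_le_minus_one) auto
  then have "L * \<alpha> \<le> 1 - \<alpha>" using assms by (simp add: field_simps)
  then show "\<alpha> / (1 - \<alpha>) \<le> 1 / L" using assms L by (simp add: divide_simps mult.commute)
  have "1 + L \<le> exp L" by simp
  also have "exp L = inverse \<alpha>" unfolding L_def using assms by simp
  finally have "\<alpha> * (1 + L) \<le> 1" using assms by (simp add: field_simps)
  then have "L / (1 + L) \<le> 1 - \<alpha>" using L by (simp add: field_simps)
  then have "ln (L / (1 + L)) \<le> ln (1 - \<alpha>)" using L assms(1,2)
    by (subst ln_le_cancel_iff) (simp_all add: divide_pos_pos)
  then have *: "- ln (1 - \<alpha>) \<le> ln (1 + L) - ln L" using L by (simp add: ln_div)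
  have "ln (2::real) \<le> 1" using ln_le_minus_one[of "2::real"] by simp
  show "- ln (1 - \<alpha>) \<le> 1 + ln_minus L"
  \<comment> \<open>The constant 1 absorbs \<open>ln 2\<close>: either \<open>1 + L \<le> 2\<close>,
    or \<open>1 + L \<le> 2 * L\<close> and \<open>ln L\<close> cancels.\<close>
  proof (cases "L \<le> 1")
    case True
    then have "ln (1 + L) \<le> ln 2" using L by simp
    then show ?thesis using * \<open>ln 2 \<le> 1\<close> unfolding ln_minus_def by simp
  next
    case False
    have "ln (1 + L) \<le> ln (2 * L)" using False by (subst ln_le_cancel_iff) auto
    also have "\<dots> = ln 2 + ln L" using L by (simp add: ln_mult)
    finally show ?thesis using * \<open>ln 2 \<le> 1\<close> unfolding ln_minus_def by simp
  qed
qed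

text \<open>The terms with \<open>i > 0\<close> telescope against \<open>ln (1 - \<alpha> ^ Suc i) / ln (inverse \<alpha>)\<close>,
  which replaces the comparison with an integral.\<close>

lemma sum_power_div_one_minus_power_le:
  fixes \<alpha> :: real
  assumes "0 < \<alpha>" "\<alpha> < 1"
  shows "(\<Sum>i<N. \<alpha> ^ Suc i / (1 - \<alpha> ^ Suc i)) \<le> (2 + ln_minus (ln (inverse \<alpha>))) / ln (inverse \<alpha>)"
proof -
  define L where "L = ln (inverse \<alpha>)"
  note L = ln_inverse_bounds[OF assms, folded L_def]
  have tele: "(\<Sum>i<Suc n. \<alpha> ^ Suc i / (1 - \<alpha> ^ Suc i)) \<le> \<alpha> / (1 - \<alpha>) + (ln (1 - \<alpha> ^ Suc n) - ln (1 - \<alpha>)) / L" for n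
  proof (induction n)
    case (Suc n)
    define u where "u = \<alpha> ^ Suc n"
    have u: "0 < u" "u < 1" "0 < u * \<alpha>" "u * \<alpha> < 1"
    proof -
      show "0 < u" "u < 1" unfolding u_def using assms by (auto simp: power_Suc_less_one simp del: power_Suc)
      then show "0 < u * \<alpha>" "u * \<alpha> < 1" using assms mult_strict_mono[of u 1 \<alpha> 1] by auto
    qed
    \<comment> \<open>Applying \<open>ln x \<le> x - 1\<close> to the ratio of consecutive values
      \<open>1 - \<alpha> ^ i\<close> bounds the logarithmic increment from below;
      \<open>L * \<alpha> \<le> 1 - \<alpha>\<close> then compares it with the new summand.\<close>
    have "ln ((1 - u) / (1 - u * \<alpha>)) \<le> (1 - u) / (1 - u * \<alpha>) - 1"
      using u by (intro ln_le_minus_one) auto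
    also have "\<dots> = - ((1 - \<alpha>) * u / (1 - u * \<alpha>))" using u by (simp add: field_simps)
    finally have "(1 - \<alpha>) * u / (1 - u * \<alpha>) \<le> ln (1 - u * \<alpha>) - ln (1 - u)"
      using u by (simp add: ln_div)
    moreover have "L * (u * \<alpha>) / (1 - u * \<alpha>) \<le> (1 - \<alpha>) * u / (1 - u * \<alpha>)"
    proof (rule divide_right_mono)
      have "L \<le> (1 - \<alpha>) / \<alpha>" using L assms by (simp add: divide_simps mult.commute)
      then have "L * \<alpha> \<le> 1 - \<alpha>" using assms by (simp add: field_simps)
      then show "L * (u * \<alpha>) \<le> (1 - \<alpha>) * u" using u by (simp add: mult.assoc mult.left_commute)
    qed (use u in simp)
    ultimately have "L * (u * \<alpha> / (1 - u * \<alpha>)) \<le> ln (1 - u * \<alpha>) - ln (1 - u)" by simp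
    then have "u * \<alpha> / (1 - u * \<alpha>) \<le> (ln (1 - u * \<alpha>) - ln (1 - u)) / L"
      using L(1) by (simp add: pos_le_divide_eq mult.commute)
    moreover have "\<alpha> ^ Suc (Suc n) = u * \<alpha>" unfolding u_def by simp
    ultimately show ?case
      using Suc unfolding sum.lessThan_Suc[of _ "Suc n"] u_def[symmetric]
      by (simp only: \<open>\<alpha> ^ Suc (Suc n) = u * \<alpha>\<close>) (simp add: diff_divide_distrib)
  qed simp
  show ?thesis
  proof (cases N)
    case 0
    then show ?thesis using L(1) unfolding L_def[symmetric] by (simp add: ln_minus_def)
  next
    case (Suc n)
    have "0 < 1 - \<alpha> ^ Suc n" using assms by (simp add: power_Suc_less_one del: power_Suc)
    then have "ln (1 - \<alpha> ^ Suc n) \<le> 0" using assms by (subst ln_le_zero_iff) auto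
    then have "(ln (1 - \<alpha> ^ Suc n) - ln (1 - \<alpha>)) / L \<le> (1 + ln_minus L) / L"
      using L by (intro divide_right_mono) auto
    \<comment> \<open>The 2 in the numerator of \<open>y\<close> arises here: one
      \<open>1 / L\<close> from the first summand, one from the bound on
      \<open>- ln (1 - \<alpha>)\<close>.\<close>
    then have "\<alpha> / (1 - \<alpha>) + (ln (1 - \<alpha> ^ Suc n) - ln (1 - \<alpha>)) / L \<le> 1 / L + (1 + ln_minus L) / L"
      using L by linarith
    also have "\<dots> = (2 + ln_minus L) / L" by (simp add: add_divide_distrib)
    finally show ?thesis using tele[of n] unfolding Suc L_def by linarith
  qed
qed

text \<open>Since \<open>y\<close> is at least \<open>2 * (\<alpha> / (1 - \<alpha>))\<close>,
  \<delta> is at most \<open>(1 - \<alpha>) / 4\<close>. Removing \<delta> from \<open>1 - u\<close>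
  with \<open>u \<le> \<alpha>\<close> therefore costs at most half, and a summand is at most
  \<open>1 + 2 * (u / (1 - u))\<close>. The total \<open>k + 2 * y\<close> fits below
  \<open>1 / \<delta> - 2\<close> by the choice of \<delta>.\<close>

lemma shrink_factor_estimates:
  fixes \<alpha> y \<delta> :: real and k :: nat
  assumes "0 < \<alpha>" "\<alpha> < 1"
    and y: "y = (2 + ln_minus (ln (inverse \<alpha>))) / ln (inverse \<alpha>)"
    and \<delta>: "\<delta> = \<alpha> / (real (Suc k) + 2 + 2 * y)"
  shows "0 < \<delta>" "\<alpha> < 1 - \<delta>"
    and "(\<Sum>i<k. (1 - \<delta>) / (1 - \<delta> - \<alpha> ^ Suc i)) + 1 \<le> (1 - \<delta>) / \<delta>"
proof -
  define L where "L = ln (inverse \<alpha>)"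
  note L = ln_inverse_bounds[OF assms(1,2), folded L_def]
  have "2 / L \<le> y" using L(1) unfolding y L_def[symmetric] by (intro divide_right_mono) (auto simp: ln_minus_def)
  with L(2) have y2: "2 * (\<alpha> / (1 - \<alpha>)) \<le> y" by simp
  have y0: "0 < y" using y2 assms by (smt (verit) divide_pos_pos)
  have D: "0 < real (Suc k) + 2 + 2 * y" using y0 by linarith
  show d0: "0 < \<delta>" unfolding \<delta> using assms D by simp
  have "\<delta> \<le> \<alpha> / (2 * y)"
    unfolding \<delta> using y0 D assms(1) by (intro divide_left_mono mult_pos_pos) linarith+
  also have "\<dots> \<le> (1 - \<alpha>) / 4"
  proof -
    have "\<alpha> * 2 \<le> y * (1 - \<alpha>)" using y2 assms(1,2) by (simp add: pos_divide_le_eq)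
    then show ?thesis using y0 by (subst pos_divide_le_eq) (auto simp: algebra_simps)
  qed
  finally have d4: "\<delta> \<le> (1 - \<alpha>) / 4" .
  then show "\<alpha> < 1 - \<delta>" using assms(2) by argo
  have inv: "1 / \<delta> = (real (Suc k) + 2 + 2 * y) / \<alpha>" unfolding \<delta> using assms by simp
  have summand_le: "(1 - \<delta>) / (1 - \<delta> - \<alpha> ^ Suc i) \<le> 1 + 2 * (\<alpha> ^ Suc i / (1 - \<alpha> ^ Suc i))" for i
  proof -
    define u where "u = \<alpha> ^ Suc i"
    have u: "0 < u" "u \<le> \<alpha>" using assms unfolding u_def by (auto simp: mult_left_le power_le_one)
    then have h: "(1 - u) / 2 \<le> 1 - \<delta> - u" using d4 assms(1,2) by argo
    have "(1 - \<delta>) / (1 - \<delta> - u) = 1 + u / (1 - \<delta> - u)"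
    proof -
      have "1 - \<delta> - u \<noteq> 0" using h u assms(2) by argo
      then show ?thesis by (simp add: field_simps)
    qed
    also have "u / (1 - \<delta> - u) \<le> u / ((1 - u) / 2)"
      using h u assms(2) by (intro divide_left_mono mult_pos_pos) auto
    also have "u / ((1 - u) / 2) = 2 * (u / (1 - u))" by simp
    finally show ?thesis unfolding u_def by (simp only: add_left_mono)
  qed
  have "(\<Sum>i<k. (1 - \<delta>) / (1 - \<delta> - \<alpha> ^ Suc i)) \<le> (\<Sum>i<k. 1 + 2 * (\<alpha> ^ Suc i / (1 - \<alpha> ^ Suc i)))"
    by (intro sum_mono summand_le)
  also have "\<dots> = k + 2 * (\<Sum>i<k. \<alpha> ^ Suc i / (1 - \<alpha> ^ Suc i))"
    by (simp add: sum.distrib sum_distrib_left)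
  also have "\<dots> \<le> k + 2 * y"
    using sum_power_div_one_minus_power_le[OF assms(1,2), of k, folded y] by simp
  also have "\<dots> \<le> 1 / \<delta> - 2"
    unfolding inv using assms D mult_left_mono[of \<alpha> 1 "real (Suc k) + 2 + 2 * y"]
    by (simp add: field_simps)
  finally show "(\<Sum>i<k. (1 - \<delta>) / (1 - \<delta> - \<alpha> ^ Suc i)) + 1 \<le> (1 - \<delta>) / \<delta>"
    using d0 by (simp add: diff_divide_distrib)
qed

section \<open>The sum over the roots at the shrunk bound\<close>

text \<open>Roots before position \<open>k\<close> lie geometrically far below \<open>t\<close>, so
  their positive terms sum to at most \<open>(1 - \<delta>) / \<delta> - 1\<close>. The term of root
  \<open>k\<close> is at most \<open>- (1 - \<delta>) / \<delta>\<close>, because that root lies in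
  the short interval between \<open>t\<close> and \<open>r k\<close>. Later roots contribute
  nonpositive terms.\<close>

lemma sum_ratio_at_shrunk_bound:
  fixes xs :: "real list" and r :: "nat \<Rightarrow> real" and \<alpha> y \<delta> t :: real
  assumes "0 < \<alpha>" "\<alpha> < 1"
    and y: "y = (2 + ln_minus (ln (inverse \<alpha>))) / ln (inverse \<alpha>)"
    and \<delta>: "\<delta> = \<alpha> / (real (Suc k) + 2 + 2 * y)"
    and k: "k < length xs" and xs: "sorted xs"
    and r: "0 < r k" "\<forall>i<k. r i \<le> \<alpha> * r (Suc i)"
    and le: "\<forall>i\<le>k. xs ! i \<le> r i"
    and t: "t = (1 - \<delta>) * r k" "t < xs ! k"
  shows "\<And>i. i < k \<Longrightarrow> xs ! i < t" and "1 + (\<Sum>i<length xs. t / (t - xs ! i)) \<le> 0"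
proof -
  note E = shrink_factor_estimates[OF assms(1-4)]
  have t0: "0 < t" unfolding t(1) using E(2) assms(1) r(1) by simp
  have geo: "r (k - Suc i) \<le> \<alpha> ^ Suc i * r k" if "i < k" for i
    using that
  proof (induction i)
    case 0
    then show ?case using r(2)[rule_format, of "k - 1"] by simp
  next
    case (Suc i)
    have "r (k - Suc (Suc i)) \<le> \<alpha> * r (k - Suc i)"
      using r(2)[rule_format, of "k - Suc (Suc i)"] Suc.prems by (simp add: Suc_diff_Suc)
    also have "\<dots> \<le> \<alpha> * (\<alpha> ^ Suc i * r k)"
      using Suc assms(1) by (intro mult_left_mono) auto
    finally show ?case by simp
  qed
  have pw: "\<alpha> ^ Suc i \<le> \<alpha>" for i using assms by (simp add: mult_left_le power_le_one)
  have small: "t * (\<alpha> ^ Suc i / (1 - \<delta>)) \<ge> xs ! (k - Suc i) \<and> \<alpha> ^ Suc i < 1 - \<delta>" if "i < k" for i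
  proof
    have "t * (\<alpha> ^ Suc i / (1 - \<delta>)) = \<alpha> ^ Suc i * r k"
      unfolding t(1) using E(2) assms(1) by simp
    then show "t * (\<alpha> ^ Suc i / (1 - \<delta>)) \<ge> xs ! (k - Suc i)"
      using geo[OF that] le[rule_format, of "k - Suc i"] by simp
    show "\<alpha> ^ Suc i < 1 - \<delta>" using pw[of i] E(2) by linarith
  qed
  show lt: "xs ! i < t" if "i < k" for i
  proof -
    have "xs ! i \<le> t * (\<alpha> ^ Suc (k - Suc i) / (1 - \<delta>))"
      using small[of "k - Suc i"] that by (simp add: Suc_diff_Suc)
    also have "\<dots> < t"
      using small[of "k - Suc i"] that t0 E(2) assms(1)
      by (simp add: mult_less_cancel_left1 del: power_Suc times_divide_eq_right)
    finally show ?thesis .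
  qed
  \<comment> \<open>Indexing by the distance below \<open>k\<close> matches each root with the power
    \<open>\<alpha> ^ Suc i\<close>.\<close>
  have "(\<Sum>i<k. t / (t - xs ! i)) = (\<Sum>i<k. t / (t - xs ! (k - Suc i)))"
    by (rule sum.nat_diff_reindex[symmetric])
  also have "\<dots> \<le> (\<Sum>i<k. (1 - \<delta>) / (1 - \<delta> - \<alpha> ^ Suc i))"
  proof (rule sum_mono)
    fix i assume "i \<in> {..<k}"
    then have s: "xs ! (k - Suc i) \<le> t * (\<alpha> ^ Suc i / (1 - \<delta>))" "\<alpha> ^ Suc i < 1 - \<delta>" using small by auto
    have "0 < 1 - \<delta>" using E(2) assms(1) by linarith
    define w where "w = \<alpha> ^ Suc i"
    have "t * (w / (1 - \<delta>)) < t"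
      using s(2) t0 \<open>0 < 1 - \<delta>\<close> unfolding w_def[symmetric]
      by (simp add: mult_less_cancel_left1 del: times_divide_eq_right)
    then have "t / (t - xs ! (k - Suc i)) \<le> t / (t - t * (w / (1 - \<delta>)))"
      using s(1) t0 unfolding w_def[symmetric]
      by (intro divide_left_mono mult_pos_pos) linarith+
    also have "\<dots> = (1 - \<delta>) / (1 - \<delta> - w)"
    proof -
      have "t - t * (w / (1 - \<delta>)) = t * ((1 - \<delta> - w) / (1 - \<delta>))"
        using \<open>0 < 1 - \<delta>\<close> by (simp add: diff_divide_distrib right_diff_distrib)
      then show ?thesis using t0 by simp
    qed
    finally show "t / (t - xs ! (k - Suc i)) \<le> (1 - \<delta>) / (1 - \<delta> - \<alpha> ^ Suc i)" unfolding w_def .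
  qed
  also have "\<dots> + 1 \<le> (1 - \<delta>) / \<delta>" by (rule E(3))
  finally have S1: "(\<Sum>i<k. t / (t - xs ! i)) + 1 \<le> (1 - \<delta>) / \<delta>" by simp
  have "(1 - \<delta>) / \<delta> = t / (r k - t)" unfolding t(1) using r(1) E(1) by (simp add: field_simps)
  also have "\<dots> \<le> t / (xs ! k - t)"
    using t0 t(2) le[rule_format, of k] by (intro divide_left_mono mult_pos_pos) auto
  also have "\<dots> = - (t / (t - xs ! k))" by (metis minus_diff_eq divide_minus_right)
  finally have S2: "(1 - \<delta>) / \<delta> \<le> - (t / (t - xs ! k))" .
  have S3: "(\<Sum>i\<in>{Suc k..<length xs}. t / (t - xs ! i)) \<le> 0"
  proof (rule sum_nonpos)
    fix i assume i: "i \<in> {Suc k..<length xs}"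
    then have "xs ! k \<le> xs ! i" using xs by (intro sorted_nth_mono) auto
    then show "t / (t - xs ! i) \<le> 0" using t0 t(2) by (intro divide_nonneg_neg) auto
  qed
  have "(\<Sum>i<length xs. t / (t - xs ! i))
      = (\<Sum>i<Suc k. t / (t - xs ! i)) + (\<Sum>i\<in>{Suc k..<length xs}. t / (t - xs ! i))"
    using k by (simp only: lessThan_atLeast0) (intro sum.atLeastLessThan_concat[symmetric]; simp)
  then show "1 + (\<Sum>i<length xs. t / (t - xs ! i)) \<le> 0" using S1 S2 S3 by simp
qed

section \<open>Root bounds for all \<open>c\<close> between 0 and 1\<close>

text \<open>Treats \<open>S\<close> and \<open>z Q'\<close> together. The roots are only claimed
  nonnegative, because \<open>c = 0\<close> makes 0 a root.\<close>

lemma shrunk_bounds_for_combination: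
  fixes A :: "real multiset" and P :: "complex poly" and r :: "nat \<Rightarrow> real"
    and \<alpha> y c :: real
  assumes pos: "\<forall>a\<in>#A. 0 < a" and n: "size A = n" "1 \<le> n" and c: "0 \<le> c" "c \<le> 1"
    and P: "P = (\<Prod>a\<in>#image_mset of_real A. [:- a, 1:])"
    and r: "\<forall>j\<in>{1..n}. 0 < r j" "\<forall>j\<in>{1..n - 1}. r j / r (j + 1) \<le> \<alpha>"
    and \<alpha>: "0 < \<alpha>" "\<alpha> < 1"
    and y: "y = (2 + ln_minus (ln (inverse \<alpha>))) / ln (inverse \<alpha>)"
    and le: "\<forall>j\<in>{1..n}. sorted_list_of_multiset A ! (j - 1) \<le> r j"
  obtains M where "proots (smult (of_real c) P + [:0, 1:] * pderiv P) = image_mset of_real M"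
    and "size M = n" and "\<forall>x\<in>#M. 0 \<le> x"
    and "\<And>j. j \<in> {1..n} \<Longrightarrow>
      j \<le> size (filter_mset (\<lambda>x. x \<le> (1 - \<alpha> / (real j + 2 + 2 * y)) * r j) M)"
proof -
  have "A \<noteq> {#}" using n by auto
  obtain g where g: "\<And>x. x \<in># A \<Longrightarrow> 0 \<le> g x \<and> g x < x \<and> {g x..<x} \<inter> set_mset A = {} \<and>
      c + (\<Sum>a\<in>#A. g x / (g x - a)) = 0"
    using exists_critical_point_in_gap[OF pos c(1)] by metis
  define M where "M = A - mset_set (set_mset A) + image_mset g (mset_set (set_mset A))"
  define xs where "xs = sorted_list_of_multiset A"
  have xs: "sorted xs" "mset xs = A" "length xs = n"
    using n(1) unfolding xs_def by (auto simp flip: size_mset)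
  have idx: "(\<Sum>a\<in>#A. t / (t - a)) = (\<Sum>i<n. t / (t - xs ! i))" for t
    unfolding xs(2)[symmetric] mset_map[symmetric] sum_mset_sum_list
    by (simp add: sum_list_sum_nth xs(3) lessThan_atLeast0)
  show ?thesis
  proof
    show "proots (smult (of_real c) P + [:0, 1:] * pderiv P) = image_mset of_real M"
      unfolding M_def using g
      by (intro proots_smult_add_X_pderiv[OF pos \<open>A \<noteq> {#}\<close> c(1) P refl]) blast
    show "size M = n"
      unfolding M_def using size_mset_mono[OF mset_set_set_mset_msubset[of A]] n(1)
      by (simp only: size_union size_image_mset size_Diff_submset[OF mset_set_set_mset_msubset]; simp)
    show "\<forall>x\<in>#M. 0 \<le> x"
      unfolding M_def using g pos by (auto dest!: in_diffD intro: less_imp_le)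
  next
    fix j assume j: "j \<in> {1..n}"
    define k where "k = j - 1"
    define \<delta> where "\<delta> = \<alpha> / (real (Suc k) + 2 + 2 * y)"
    define t where "t = (1 - \<delta>) * r (Suc k)"
    have jk: "j = Suc k" and k: "k < n" using j by (auto simp: k_def)
    note count = size_filter_proots_combination[OF pos _ M_def, of c t]
    have count_ge: "i < size (filter_mset (\<lambda>x. x \<le> t) A)" if "xs ! i \<le> t" "i < n" for i
      using sorted_list_of_multiset_nth_le_iff[of i A t] that n(1) unfolding xs_def by simp
    have "Suc k \<le> size (filter_mset (\<lambda>x. x \<le> t) M)"
    \<comment> \<open>If root \<open>k\<close> of \<open>A\<close> is already at most
      \<open>t\<close>, counts that cannot drop suffice. Otherwise exactly the first
      \<open>k\<close> roots lie below \<open>t\<close>, and the strict increase supplies the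
      missing one.\<close>
    proof (cases "xs ! k \<le> t")
      case True
      from count_ge[OF True k] count(1) g show ?thesis by fastforce
    next
      case False
      have ratio: "\<forall>i<k. r (Suc i) \<le> \<alpha> * r (Suc (Suc i))"
      proof (intro allI impI)
        fix i assume that: "i < k"
        have "Suc i \<in> {1..n - 1}" "Suc (Suc i) \<in> {1..n}" using that k by auto
        then have "r (Suc i) / r (Suc (Suc i)) \<le> \<alpha>" "0 < r (Suc (Suc i))"
          using r by auto
        then show "r (Suc i) \<le> \<alpha> * r (Suc (Suc i))" by (simp add: pos_divide_le_eq)
      qed
      have bound: "\<forall>i\<le>k. xs ! i \<le> r (Suc i)"
        using le k unfolding xs_def by force
      have rk: "0 < r (Suc k)" using r(1) k by auto
      have "k < length xs" using k xs(3) by simp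
      note B = sum_ratio_at_shrunk_bound[of \<alpha> y \<delta> k xs "\<lambda>i. r (Suc i)" t,
          OF \<alpha> y \<delta>_def this xs(1) rk ratio bound t_def, unfolded xs(3)]
      have "t < xs ! k" using False by simp
      have "t \<notin># A"
      proof
        assume "t \<in># A"
        then obtain i where i: "i < n" "t = xs ! i"
          using xs by (metis in_set_conv_nth set_mset_mset)
        show False
        proof (cases "i < k")
          case True
          then show False using B(1)[OF \<open>t < xs ! k\<close> True] i by simp
        next
          case F: False
          then have "xs ! k \<le> xs ! i" using xs i by (intro sorted_nth_mono) auto
          then show False using \<open>t < xs ! k\<close> i by simp
        qed
      qed
      moreover have "xs ! k \<in># A" using k xs by (metis nth_mem set_mset_mset)
      \<comment> \<open>The sum is at most -1, and \<open>c \<le> 1\<close>.\<close>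
      moreover have "c + (\<Sum>a\<in>#A. t / (t - a)) \<le> 0"
        unfolding idx using B(2)[OF \<open>t < xs ! k\<close>] c(2) by linarith
      ultimately have "size (filter_mset (\<lambda>x. x \<le> t) A) < size (filter_mset (\<lambda>x. x \<le> t) M)"
        using count(2) g \<open>t < xs ! k\<close> by blast
      moreover have "k \<le> size (filter_mset (\<lambda>x. x \<le> t) A)"
      proof (cases k)
        case (Suc i)
        then have "xs ! i \<le> t" using B(1)[OF \<open>t < xs ! k\<close>, of i] by simp
        then show ?thesis using count_ge[of i] Suc k by simp
      qed simp
      ultimately show ?thesis by simp
    qed
    then show "j \<le> size (filter_mset (\<lambda>x. x \<le> (1 - \<alpha> / (real j + 2 + 2 * y)) * r j) M)"
      unfolding jk t_def \<delta>_def .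
  qed
qed

section \<open>Transfer to complex polynomials and conclusion\<close>

lemma jth_smallest_root_le_iff:
  assumes "proots p = image_mset of_real M" "1 \<le> j" "j \<le> size M"
  shows "jth_smallest_root p j \<le> t \<longleftrightarrow> j \<le> size (filter_mset (\<lambda>x. x \<le> t) M)"
proof -
  have "image_mset Re (proots p) = M"
    unfolding assms(1) by (simp add: image_mset.compositionality o_def)
  then show ?thesis
    unfolding jth_smallest_root_def
    using sorted_list_of_multiset_nth_le_iff[of "j - 1" M t] assms(2,3) by auto
qed

lemma all_roots_pos_iff_proots:
  assumes "p \<noteq> 0" "proots p = image_mset of_real M"
  shows "all_roots_pos p \<longleftrightarrow> (\<forall>x\<in>#M. 0 < x)"
proof -
  have "{z. poly p z = 0} = of_real ` set_mset M"
    using assms by (metis set_count_proots set_image_mset)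
  then have "poly p z = 0 \<longleftrightarrow> z \<in> of_real ` set_mset M" for z by blast
  then show ?thesis unfolding all_roots_pos_def by auto
qed

theorem lemma2p1:
  fixes Q :: "complex poly" and n :: nat and r :: "nat \<Rightarrow> real" and \<alpha> y :: real
  assumes "n \<ge> 1" and "degree Q = n" and "all_roots_pos Q"
    and "\<forall>j\<in>{1..n}. r j > 0" and "strict_mono_on {1..n} r"
    and "0 < \<alpha>" and "\<alpha> < 1"
    and "\<forall>j\<in>{1..n-1}. r j / r (j + 1) \<le> \<alpha>"
    and "y = (2 + ln_minus (ln (inverse \<alpha>))) / ln (inverse \<alpha>)"
    and "\<forall>j\<in>{1..n}. jth_smallest_root Q j \<le> r j"
  shows "(\<forall>m q :: int. m \<ge> 1 \<longrightarrow> 1 \<le> q \<longrightarrow> q \<le> m - 1 \<longrightarrow>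
            (let S = smult (of_int q) Q + smult (of_int m) ([:0, 1:] * pderiv Q)
             in all_roots_pos S \<and>
                (\<forall>j\<in>{1..n}. jth_smallest_root S j \<le> (1 - \<alpha> / (real j + 2 + 2 * y)) * r j)))
         \<and> all_roots_pos (pderiv Q)
         \<and> (\<forall>j\<in>{2..n}. jth_smallest_root (pderiv Q) (j - 1)
                          \<le> (1 - \<alpha> / (real j + 2 + 2 * y)) * r j)"

proof -
  define A where "A = image_mset Re (proots Q)"
  define P where "P = (\<Prod>a\<in>#image_mset of_real A. [:- a, 1:] :: complex poly)"
  define l where "l = lead_coeff Q"
  have "Q \<noteq> 0" using assms(1,2) by auto
  then have "l \<noteq> 0" by (simp add: l_def)
  have root: "z = of_real (Re z)" "0 < Re z" if "z \<in># proots Q" for z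
    using that assms(3) \<open>Q \<noteq> 0\<close> by (auto simp: all_roots_pos_def complex_is_Real_iff complex_eq_iff)
  have proots_Q: "proots Q = image_mset of_real A"
  proof -
    have "image_mset (\<lambda>z. of_real (Re z)) (proots Q) = image_mset (\<lambda>z. z) (proots Q)"
      using root(1) by (intro image_mset_cong) metis
    then show ?thesis unfolding A_def by (simp add: image_mset.compositionality o_def)
  qed
  have Q: "Q = smult l P"
    unfolding P_def l_def proots_Q[symmetric]
    by (rule complex_poly_decompose_multiset[symmetric])
  have "P \<noteq> 0" using Q \<open>Q \<noteq> 0\<close> by auto
  have pos: "\<forall>a\<in>#A. 0 < a" unfolding A_def using root(2) by auto
  have szA: "size A = n"
    unfolding A_def using size_proots_complex[of Q] assms(2) by simp
  have le: "\<forall>j\<in>{1..n}. sorted_list_of_multiset A ! (j - 1) \<le> r j"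
    using assms(10) unfolding jth_smallest_root_def A_def .
  \<comment> \<open>These turn nonnegative roots into positive ones later. For \<open>P'\<close>,
    all terms \<open>1 / (0 - a)\<close> are negative, so the logarithmic derivative at 0 cannot
    vanish.\<close>
  have P0: "poly P 0 \<noteq> 0" and P'0: "poly (pderiv P) 0 \<noteq> 0"
  proof -
    have "0 \<notin># A" using pos by auto
    then have prod: "(\<Prod>a\<in>#A. 0 - a) \<noteq> 0" by (auto simp: prod_mset_zero_iff)
    then show "poly P 0 \<noteq> 0"
      unfolding P_def using poly_prod_linear_of_real[of A 0, where 'a=complex] by simp
    obtain a B where A: "A = add_mset a B" using szA assms(1) by (cases A) auto
    have "(\<Sum>b\<in>#B. 0) \<le> (\<Sum>b\<in>#B. 1 / b)"
      using pos A by (intro sum_mset_mono) (auto intro: less_imp_le)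
    then have "(\<Sum>a\<in>#A. 1 / a) > 0"
      using pos by (auto simp: A intro!: add_pos_nonneg)
    moreover have "(\<Sum>a\<in>#A. 1 / (0 - a)) = - (\<Sum>a\<in>#A. 1 / a)"
      by (induction A) auto
    ultimately have "(\<Sum>a\<in>#A. 1 / (0 - a)) \<noteq> 0" by linarith
    with prod have "(\<Prod>a\<in>#A. 0 - a) * (\<Sum>a\<in>#A. 1 / (0 - a)) \<noteq> 0"
      by (rule no_zero_divisors)
    then show "poly (pderiv P) 0 \<noteq> 0"
      unfolding P_def
      using poly_pderiv_prod_linear_of_real[OF \<open>0 \<notin># A\<close>, where 'a=complex]
      by (metis of_real_0 of_real_eq_0_iff)
  qed
  note bounds = shrunk_bounds_for_combination[OF pos szA assms(1) _ _ P_def assms(4,8,6,7,9) le]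
  show ?thesis
  proof (intro conjI allI impI)
    fix m q :: int
    assume mq: "m \<ge> 1" "1 \<le> q" "q \<le> m - 1"
    define c :: real where "c = of_int q / of_int m"
    have c: "0 \<le> c" "c \<le> 1" "c \<noteq> 0" using mq by (auto simp: c_def)
    define S where "S = smult (of_int q) Q + smult (of_int m) ([:0, 1:] * pderiv Q)"
    define T where "T = smult (of_real c) P + [:0, 1:] * pderiv P"
    have "poly T 0 \<noteq> 0" unfolding T_def using P0 c(3) by simp
    then have "T \<noteq> 0" by auto
    have ml: "of_int m * l \<noteq> 0" using mq \<open>l \<noteq> 0\<close> by auto
    \<comment> \<open>With \<open>c = q / m\<close>, a nonzero constant is all that separates
      \<open>S\<close> from the normalized \<open>T\<close>.\<close>
    have "S = smult (of_int m * l) T"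
      unfolding S_def T_def Q c_def using mq
      by (simp add: pderiv_smult smult_add_right mult.commute)
    then have "S \<noteq> 0" "proots S = proots T" using ml \<open>T \<noteq> 0\<close> by auto
    obtain M where M: "proots T = image_mset of_real M" "size M = n" "\<forall>x\<in>#M. 0 \<le> x"
      "\<And>j. j \<in> {1..n} \<Longrightarrow>
        j \<le> size (filter_mset (\<lambda>x. x \<le> (1 - \<alpha> / (real j + 2 + 2 * y)) * r j) M)"
      using bounds[OF c(1,2)] unfolding T_def by blast
    have "0 \<notin># M"
    proof
      assume "0 \<in># M"
      then have "0 \<in># proots T" unfolding M(1) by force
      then show False using \<open>poly T 0 \<noteq> 0\<close> \<open>T \<noteq> 0\<close> by simp
    qed
    then have "\<forall>x\<in>#M. 0 < x" using M(3) by (metis order.order_iff_strict)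
    then have "all_roots_pos S"
      using all_roots_pos_iff_proots[OF \<open>S \<noteq> 0\<close>] M(1) \<open>proots S = proots T\<close> by simp
    moreover have "\<forall>j\<in>{1..n}. jth_smallest_root S j \<le> (1 - \<alpha> / (real j + 2 + 2 * y)) * r j"
      using M jth_smallest_root_le_iff[of S M] \<open>proots S = proots T\<close> by simp
    ultimately show "let S = smult (of_int q) Q + smult (of_int m) ([:0, 1:] * pderiv Q)
             in all_roots_pos S \<and>
                (\<forall>j\<in>{1..n}. jth_smallest_root S j \<le> (1 - \<alpha> / (real j + 2 + 2 * y)) * r j)"
      unfolding Let_def S_def by blast
  next
    obtain M where M: "proots ([:0, 1:] * pderiv P) = image_mset of_real M" "size M = n" "\<forall>x\<in>#M. 0 \<le> x"
      "\<And>j. j \<in> {1..n} \<Longrightarrow>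
        j \<le> size (filter_mset (\<lambda>x. x \<le> (1 - \<alpha> / (real j + 2 + 2 * y)) * r j) M)"
      using bounds[of 0] by auto
    have "pderiv P \<noteq> 0" using P'0 by auto
    have "proots (pderiv Q) = proots (pderiv P)" "pderiv Q \<noteq> 0"
      unfolding Q using \<open>l \<noteq> 0\<close> \<open>pderiv P \<noteq> 0\<close> by (auto simp: pderiv_smult)
    \<comment> \<open>With \<open>c = 0\<close> the roots are those of \<open>P'\<close> together
      with a single extra 0, which is removed to form \<open>N\<close>.\<close>
    have split: "image_mset of_real M = add_mset 0 (proots (pderiv P))"
      using proots_mult[of "[:0, 1:]" "pderiv P"] \<open>pderiv P \<noteq> 0\<close>
      unfolding M(1)[symmetric] by (simp del: mult_pCons_left)
    then have "(0::complex) \<in># image_mset of_real M" by simp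
    then have "0 \<in># M" by auto
    then obtain N where N: "M = add_mset 0 N" by (meson multi_member_split)
    have proots_Q': "proots (pderiv Q) = image_mset of_real N"
      using split \<open>proots (pderiv Q) = proots (pderiv P)\<close> unfolding N by simp
    have "0 \<notin># N"
    proof
      assume "0 \<in># N"
      then have "0 \<in># proots (pderiv P)"
        using proots_Q' \<open>proots (pderiv Q) = proots (pderiv P)\<close> by force
      then show False using P'0 \<open>pderiv P \<noteq> 0\<close> by simp
    qed
    then have "\<forall>x\<in>#N. 0 < x" using M(3) N by (metis order.order_iff_strict union_iff add_mset_add_single)
    then show "all_roots_pos (pderiv Q)"
      using all_roots_pos_iff_proots[OF \<open>pderiv Q \<noteq> 0\<close> proots_Q'] by simp
    show "\<forall>j\<in>{2..n}. jth_smallest_root (pderiv Q) (j - 1) \<le> (1 - \<alpha> / (real j + 2 + 2 * y)) * r j"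
    proof
      fix j assume j: "j \<in> {2..n}"
      let ?t = "(1 - \<alpha> / (real j + 2 + 2 * y)) * r j"
      have "j \<le> size (filter_mset (\<lambda>x. x \<le> ?t) M)" using M(4)[of j] j by simp
      \<comment> \<open>Removing the 0 costs at most one of the \<open>j\<close> counted roots,
        whence the index shift.\<close>
      then have "j - 1 \<le> size (filter_mset (\<lambda>x. x \<le> ?t) N)"
        unfolding N by (auto split: if_splits)
      moreover have "1 \<le> j - 1" "j - 1 \<le> size N" using j M(2) N by auto
      ultimately show "jth_smallest_root (pderiv Q) (j - 1) \<le> ?t"
        using jth_smallest_root_le_iff[OF proots_Q'] by blast
    qed
  qed
qed

end
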